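(* Every infinite strongly stable field is perfect.
   Context: A stable field is a field $K$ considered as a first-order structure, endowed with its field operations and possibly additional relations, such that $\mathrm{Th}(K)$ is stable. By convention $K$ is a monster model (very saturated model) of its theory, and sets of parameters are small, i.e. of cardinality less than the degree of saturation. All complete types are finitary (in finitely many variables). Weight: in a stable theory with monster model $\mathfrak{C}$, for $A\subseteq \mathfrak{C}$ and $p\in S(A)$, the weight of $p$ is the supremum of the cardinalities $\kappa$ for which there exist a non-forking extension $q=\mathrm{tp}(a/B)\in S(B)$ of $p$ and a $B$-independent sequence $(b_i:i<\kappa)$ (of finite tuples) such that for every $i<\kappa$, $a$ is not independent (in the sense of forking) from $b_i$ over $A$. A theory is strongly stable if it is stable and all its (finitary, complete) types over small sets of parameters have finite weight (equivalently, it is stable and strongly dependent). A field is strongly stable if its theory (in the possibly expanded language) is strongly stable. *)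

theory Defs
  imports "HOL-Computational_Algebra.Computational_Algebra" "HOL-Library.Extended_Nat"
begin

unbundle cardinal_syntax

section \<open>First-order logic\<close>

text \<open>
  Symbols carry no fixed arity: a symbol applied to a list of \<open>k\<close> arguments is a symbol of
  arity \<open>k\<close>, and occurrences with different numbers of arguments are independent of each other.
  A structure for a signature with fixed arities is obtained by interpreting the superfluous
  symbols trivially, which changes neither the definable sets nor the cardinality of the set of
  formulas. All structures are non-empty with a type as their universe.
\<close>

datatype 'f tm = Var nat | Fun 'f "'f tm list"

datatype ('f, 'r) fm =
    Eq "'f tm" "'f tm"
  | Rel 'r "'f tm list"
  | Neg "('f, 'r) fm"
  | Conj "('f, 'r) fm" "('f, 'r) fm"
  | Exists nat "('f, 'r) fm"

record ('f, 'r, 'a) fo_struct =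
  fun_of :: "'f \<Rightarrow> 'a list \<Rightarrow> 'a"
  rel_of :: "'r \<Rightarrow> 'a list \<Rightarrow> bool"

primrec fv_tm :: "'f tm \<Rightarrow> nat set" where
  "fv_tm (Var x) = {x}"
| "fv_tm (Fun f ts) = \<Union> (set (map fv_tm ts))"

primrec fv :: "('f, 'r) fm \<Rightarrow> nat set" where
  "fv (Eq t u) = fv_tm t \<union> fv_tm u"
| "fv (Rel r ts) = \<Union> (fv_tm ` set ts)"
| "fv (Neg \<phi>) = fv \<phi>"
| "fv (Conj \<phi> \<psi>) = fv \<phi> \<union> fv \<psi>"
| "fv (Exists x \<phi>) = fv \<phi> - {x}"

primrec eval_tm :: "('f, 'r, 'a) fo_struct \<Rightarrow> (nat \<Rightarrow> 'a) \<Rightarrow> 'f tm \<Rightarrow> 'a" where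
  "eval_tm M s (Var x) = s x"
| "eval_tm M s (Fun f ts) = fun_of M f (map (eval_tm M s) ts)"

primrec sat :: "('f, 'r, 'a) fo_struct \<Rightarrow> (nat \<Rightarrow> 'a) \<Rightarrow> ('f, 'r) fm \<Rightarrow> bool" where
  "sat M s (Eq t u) \<longleftrightarrow> eval_tm M s t = eval_tm M s u"
| "sat M s (Rel r ts) \<longleftrightarrow> rel_of M r (map (eval_tm M s) ts)"
| "sat M s (Neg \<phi>) \<longleftrightarrow> \<not> sat M s \<phi>"
| "sat M s (Conj \<phi> \<psi>) \<longleftrightarrow> sat M s \<phi> \<and> sat M s \<psi>"
| "sat M s (Exists x \<phi>) \<longleftrightarrow> (\<exists>a. sat M (s(x := a)) \<phi>)"

definition Th :: "('f, 'r, 'a) fo_struct \<Rightarrow> ('f, 'r) fm set" where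
  "Th M = {\<phi>. fv \<phi> = {} \<and> (\<forall>s. sat M s \<phi>)}"

section \<open>Types and saturation\<close>

text \<open>
  A formula with parameters is a pair \<open>(\<phi>, b)\<close> of a formula and a tuple. As a formula in \<open>n\<close> object
  variables, its variables \<open>0, \<dots>, n - 1\<close> are the object variables, and the subsequent
  ones stand for the entries of \<open>b\<close>.
\<close>

definition pforms :: "nat \<Rightarrow> 'a set \<Rightarrow> (('f, 'r) fm \<times> 'a list) set" where
  "pforms n A = {(\<phi>, b). set b \<subseteq> A \<and> fv \<phi> \<subseteq> {..<n + length b}}"

definition holds :: "('f, 'r, 'a) fo_struct \<Rightarrow> 'a list \<Rightarrow> ('f, 'r) fm \<times> 'a list \<Rightarrow> bool" where
  "holds M a = (\<lambda>(\<phi>, b). sat M (\<lambda>i. (a @ b) ! i) \<phi>)"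

definition realizes ::
  "('f, 'r, 'a) fo_struct \<Rightarrow> nat \<Rightarrow> 'a list \<Rightarrow> (('f, 'r) fm \<times> 'a list) set \<Rightarrow> bool" where
  "realizes M n a p \<longleftrightarrow> length a = n \<and> (\<forall>\<theta>\<in>p. holds M a \<theta>)"

definition tp :: "('f, 'r, 'a) fo_struct \<Rightarrow> 'a list \<Rightarrow> 'a set \<Rightarrow> (('f, 'r) fm \<times> 'a list) set" where
  "tp M a A = {\<theta> \<in> pforms (length a) A. holds M a \<theta>}"

definition complete_types ::
  "('f, 'r, 'a) fo_struct \<Rightarrow> nat \<Rightarrow> 'a set \<Rightarrow> (('f, 'r) fm \<times> 'a list) set set" where
  "complete_types M n A =
     {p. p \<subseteq> pforms n A \<and>
         (\<forall>F. finite F \<and> F \<subseteq> p \<longrightarrow> (\<exists>a. realizes M n a F)) \<and>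
         (\<forall>(\<phi>, b)\<in>pforms n A. (\<phi>, b) \<in> p \<or> (Neg \<phi>, b) \<in> p)}"

definition small :: "'c rel \<Rightarrow> 'a set \<Rightarrow> bool" where
  "small \<kappa> A \<longleftrightarrow> |A| <o \<kappa>"

definition saturated :: "'c rel \<Rightarrow> ('f, 'r, 'a) fo_struct \<Rightarrow> bool" where
  "saturated \<kappa> M \<longleftrightarrow>
     (\<forall>A n p. small \<kappa> A \<and> p \<in> complete_types M n A \<longrightarrow> (\<exists>a. realizes M n a p))"

text \<open>
  The degree of saturation \<open>\<kappa>\<close> has to exceed \<open>|L| + \<aleph>\<^sub>0\<close>, the cardinality of the set of all formulas.
\<close>

definition monster_model ::
  "'c rel \<Rightarrow> ('f, 'r) fm set \<Rightarrow> ('f, 'r, 'a) fo_struct \<Rightarrow> bool" where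
  "monster_model \<kappa> T M \<longleftrightarrow>
     Card_order \<kappa> \<and> |UNIV :: ('f, 'r) fm set| <o \<kappa> \<and> Th M = T \<and> saturated \<kappa> M"

section \<open>Stability, forking and weight, computed in a monster model\<close>

text \<open>Stability as the absence of a formula with the order property.\<close>

definition stable :: "('f, 'r, 'a) fo_struct \<Rightarrow> bool" where
  "stable M \<longleftrightarrow>
     \<not> (\<exists>\<phi> m n (a :: nat \<Rightarrow> 'a list) (b :: nat \<Rightarrow> 'a list).
          fv \<phi> \<subseteq> {..<m + n} \<and> (\<forall>i. length (a i) = m \<and> length (b i) = n) \<and>
          (\<forall>i j. holds M (a i) (\<phi>, b j) \<longleftrightarrow> i < j))"

text \<open>
  \<open>\<phi>(x, b)\<close> divides over \<open>A\<close> if, for some \<open>k\<close>, there are realizations \<open>c\<^sub>0, c\<^sub>1, \<dots>\<close> of \<open>tp(b/A)\<close> such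
  that the family of the \<open>\<phi>(x, c\<^sub>i)\<close> is \<open>k\<close>-inconsistent.
\<close>

definition divides ::
  "('f, 'r, 'a) fo_struct \<Rightarrow> nat \<Rightarrow> 'a set \<Rightarrow> ('f, 'r) fm \<times> 'a list \<Rightarrow> bool" where
  "divides M n A = (\<lambda>(\<phi>, b).
     \<exists>(k :: nat) (c :: nat \<Rightarrow> 'a list).
       (\<forall>i. realizes M (length b) (c i) (tp M b A)) \<and>
       (\<forall>I. finite I \<and> card I = k \<longrightarrow> \<not> (\<exists>a. realizes M n a ((\<lambda>i. (\<phi>, c i)) ` I))))"

text \<open>
  A type forks over \<open>A\<close> if it implies a finite disjunction of formulas, with parameters anywhere in
  the monster model, each of which divides over \<open>A\<close>.
\<close>

definition forks ::
  "('f, 'r, 'a) fo_struct \<Rightarrow> nat \<Rightarrow> 'a set \<Rightarrow> (('f, 'r) fm \<times> 'a list) set \<Rightarrow> bool" where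
  "forks M n A p \<longleftrightarrow>
     (\<exists>D. finite D \<and> D \<subseteq> pforms n UNIV \<and> (\<forall>\<delta>\<in>D. divides M n A \<delta>) \<and>
          (\<forall>a. realizes M n a p \<longrightarrow> (\<exists>\<delta>\<in>D. holds M a \<delta>)))"

text \<open>\<open>indep M a A B\<close>: the tuple \<open>a\<close> is independent from \<open>B\<close> over \<open>A\<close>.\<close>

definition indep :: "('f, 'r, 'a) fo_struct \<Rightarrow> 'a list \<Rightarrow> 'a set \<Rightarrow> 'a set \<Rightarrow> bool" where
  "indep M a A B \<longleftrightarrow> \<not> forks M (length a) A (tp M a (A \<union> B))"

definition indep_seq ::
  "('f, 'r, 'a) fo_struct \<Rightarrow> 'a set \<Rightarrow> enat \<Rightarrow> (nat \<Rightarrow> 'a list) \<Rightarrow> bool" where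
  "indep_seq M B \<nu> b \<longleftrightarrow> (\<forall>i. enat i < \<nu> \<longrightarrow> indep M (b i) B (\<Union>j<i. set (b j)))"

text \<open>
  The weight of an \<open>n\<close>-type \<open>p\<close> over \<open>A\<close>. The set consists of the lengths of the sequences \<open>b\<close> that
  witness the weight, with all infinite cardinalities identified to \<open>\<infinity>\<close>; sequences of length at most
  \<open>\<omega>\<close> suffice for this, since an initial segment of a witness is a witness.
\<close>

definition weight ::
  "'c rel \<Rightarrow> ('f, 'r, 'a) fo_struct \<Rightarrow> nat \<Rightarrow> 'a set \<Rightarrow> (('f, 'r) fm \<times> 'a list) set \<Rightarrow> enat" where
  "weight \<kappa> M n A p =
     Sup {\<nu>. \<exists>B a b.
            small \<kappa> B \<and> A \<subseteq> B \<and> length a = n \<and>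
            p \<subseteq> tp M a B \<and> \<not> forks M n A (tp M a B) \<and>
            indep_seq M B \<nu> b \<and>
            (\<forall>i. enat i < \<nu> \<longrightarrow> \<not> indep M a A (set (b i)))}"

definition strongly_stable :: "'c rel \<Rightarrow> ('f, 'r, 'a) fo_struct \<Rightarrow> bool" where
  "strongly_stable \<kappa> M \<longleftrightarrow>
     stable M \<and>
     (\<forall>A n p. small \<kappa> A \<and> p \<in> complete_types M n A \<longrightarrow> weight \<kappa> M n A p < \<infinity>)"

section \<open>Fields with additional relations\<close>

datatype ring_sym = RZero | ROne | RAdd | RNeg | RMul

text \<open>
  The last equation covers the superfluous symbols, those with a wrong number of arguments.
\<close>

fun ring_fun :: "ring_sym \<Rightarrow> 'a::field list \<Rightarrow> 'a" where
  "ring_fun RZero [] = 0"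
| "ring_fun ROne [] = 1"
| "ring_fun RAdd [x, y] = x + y"
| "ring_fun RNeg [x] = - x"
| "ring_fun RMul [x, y] = x * y"
| "ring_fun _ _ = 0"

definition field_struct :: "('r \<Rightarrow> 'a::field list \<Rightarrow> bool) \<Rightarrow> (ring_sym, 'r, 'a) fo_struct" where
  "field_struct R = \<lparr>fun_of = ring_fun, rel_of = R\<rparr>"

definition perfect_field :: "'a::field itself \<Rightarrow> bool" where
  "perfect_field _ \<longleftrightarrow> CHAR('a) = 0 \<or> (\<forall>x::'a. \<exists>y. y ^ CHAR('a) = x)"

end

theory Submission
  imports Defs
begin

text \<open>
  If \<open>a\<close> is not a \<open>p\<close>-th power, then \<open>g(x, y) = x\<^sup>p + a y\<^sup>p\<close> is a definable injection of the square of the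
  field into the field. By saturation, every sequence \<open>x\<^sub>0, x\<^sub>1, \<dots>\<close> is coded by a single element \<open>y\<close>
  with \<open>y = g(x\<^sub>0, g(x\<^sub>1, \<dots> g(x\<^sub>n, _)))\<close> for all \<open>n\<close>. Over a small elementary submodel \<open>A\<close>, take for
  \<open>x\<^sub>i\<close> a sequence of distinct realizations of one type over \<open>A\<close> such that the type of \<open>x\<^sub>i\<close> over
  \<open>A \<union> {x\<^sub>0, \<dots>, x\<^bsub>i-1\<^esub>}\<close> is finitely satisfiable in \<open>A\<close>. A type finitely satisfiable in \<open>A\<close> does not
  fork over \<open>A\<close>, so the sequence is independent. The formula ``\<open>x\<^sub>i\<close> is the \<open>i\<close>-th entry coded by \<open>y\<close>''
  2-divides over \<open>A\<close>, since its instances at distinct \<open>x\<^sub>j\<close> contradict each other. Hence the type of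
  \<open>y\<close> over \<open>A\<close> has infinite weight.
\<close>

section \<open>Syntax\<close>

lemma eval_tm_cong: "(\<And>i. i \<in> fv_tm t \<Longrightarrow> s i = s' i) \<Longrightarrow> eval_tm M s t = eval_tm M s' t"
proof (induction t)
  case (Fun f ts)
  have "map (eval_tm M s) ts = map (eval_tm M s') ts"
    using Fun by (intro map_cong) auto
  then show ?case by (simp only: eval_tm.simps)
qed simp

lemma sat_cong: "(\<And>i. i \<in> fv \<phi> \<Longrightarrow> s i = s' i) \<Longrightarrow> sat M s \<phi> \<longleftrightarrow> sat M s' \<phi>"
proof (induction \<phi> arbitrary: s s')
  case (Eq t u)
  then have "eval_tm M s t = eval_tm M s' t" "eval_tm M s u = eval_tm M s' u"
    by (auto intro!: eval_tm_cong)
  then show ?case by simp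
next
  case (Rel r ts)
  have "map (eval_tm M s) ts = map (eval_tm M s') ts"
    using Rel by (intro map_cong refl eval_tm_cong) auto
  then show ?case by (simp only: sat.simps)
next
  case (Neg \<phi>)
  then have "sat M s \<phi> \<longleftrightarrow> sat M s' \<phi>" by (intro Neg.IH) auto
  then show ?case by simp
next
  case (Conj \<phi> \<psi>)
  have "sat M s \<phi> \<longleftrightarrow> sat M s' \<phi>" by (rule Conj.IH(1)) (simp add: Conj.prems)
  moreover have "sat M s \<psi> \<longleftrightarrow> sat M s' \<psi>" by (rule Conj.IH(2)) (simp add: Conj.prems)
  ultimately show ?case by simp
next
  case (Exists x \<phi>)
  have "sat M (s(x := a)) \<phi> \<longleftrightarrow> sat M (s'(x := a)) \<phi>" for a
    using Exists by (intro Exists.IH) auto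
  then show ?case by simp
qed

section \<open>Renaming variables and exchanging object variables with parameters\<close>

primrec rename_tm :: "(nat \<Rightarrow> nat) \<Rightarrow> 'f tm \<Rightarrow> 'f tm" where
  "rename_tm f (Var x) = Var (f x)"
| "rename_tm f (Fun g ts) = Fun g (map (rename_tm f) ts)"

text \<open>Bound variables are renamed as well, which is harmless for injective renamings.\<close>

primrec rename :: "(nat \<Rightarrow> nat) \<Rightarrow> ('f, 'r) fm \<Rightarrow> ('f, 'r) fm" where
  "rename f (Eq t u) = Eq (rename_tm f t) (rename_tm f u)"
| "rename f (Rel r ts) = Rel r (map (rename_tm f) ts)"
| "rename f (Neg \<phi>) = Neg (rename f \<phi>)"
| "rename f (Conj \<phi> \<psi>) = Conj (rename f \<phi>) (rename f \<psi>)"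
| "rename f (Exists x \<phi>) = Exists (f x) (rename f \<phi>)"

lemma fv_rename_tm: "fv_tm (rename_tm f t) = f ` fv_tm t"
  by (induction t) auto

lemma fv_rename: "inj f \<Longrightarrow> fv (rename f \<phi>) = f ` fv \<phi>"
  by (induction \<phi>) (auto simp: fv_rename_tm inj_def)

lemma eval_rename_tm: "eval_tm M s (rename_tm f t) = eval_tm M (s \<circ> f) t"
proof (induction t)
  case (Fun g ts)
  then have "map (eval_tm M s \<circ> rename_tm f) ts = map (eval_tm M (s \<circ> f)) ts"
    by (simp add: comp_def)
  then show ?case by (simp only: rename_tm.simps eval_tm.simps map_map)
qed simp

lemma sat_rename: "inj f \<Longrightarrow> sat M s (rename f \<phi>) \<longleftrightarrow> sat M (s \<circ> f) \<phi>"
proof (induction \<phi> arbitrary: s)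
  case (Eq t u)
  show ?case by (simp only: rename.simps sat.simps eval_rename_tm)
next
  case (Rel r ts)
  have "map (eval_tm M s \<circ> rename_tm f) ts = map (eval_tm M (s \<circ> f)) ts"
    by (simp add: eval_rename_tm)
  then show ?case by (simp only: rename.simps sat.simps map_map)
next
  case (Exists x \<phi>)
  have "s(f x := a) \<circ> f = (s \<circ> f)(x := a)" for a
    using Exists.prems by (auto simp: inj_def fun_eq_iff)
  then show ?case by (simp only: rename.simps sat.simps Exists.IH[OF Exists.prems])
qed auto

text \<open>Turns a formula about an \<open>n\<close>-tuple \<open>a\<close> with parameters
  \<open>b\<close> of length \<open>l\<close> into one about \<open>b\<close> with parameters
  \<open>a\<close>. The identity from \<open>n + l\<close> on makes the map injective on all
  variables, as the renaming of bound ones requires.\<close>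

definition block_swap :: "nat \<Rightarrow> nat \<Rightarrow> nat \<Rightarrow> nat" where
  "block_swap n l i = (if i < n then i + l else if i < n + l then i - n else i)"

lemma inj_block_swap: "inj (block_swap n l)"
  by (auto simp: inj_def block_swap_def split: if_splits)

lemma holds_swap:
  assumes "fv \<phi> \<subseteq> {..<length a + length b}"
  shows "holds M b (rename (block_swap (length a) (length b)) \<phi>, a) \<longleftrightarrow> holds M a (\<phi>, b)"
proof -
  have "sat M ((\<lambda>i. (b @ a) ! i) \<circ> block_swap (length a) (length b)) \<phi>
      \<longleftrightarrow> sat M (\<lambda>i. (a @ b) ! i) \<phi>"
    using assms by (intro sat_cong) (auto simp: block_swap_def nth_append)
  then show ?thesis by (simp add: holds_def sat_rename[OF inj_block_swap])
qed

lemma fv_swap: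
  assumes "fv \<phi> \<subseteq> {..<n + l}"
  shows "fv (rename (block_swap n l) \<phi>) \<subseteq> {..<l + n}"
proof -
  have "block_swap n l i < l + n" if "i < n + l" for i
    using that by (auto simp: block_swap_def)
  then show ?thesis using assms by (auto simp: fv_rename[OF inj_block_swap])
qed

section \<open>Finite satisfiability\<close>

text \<open>For complete types over a superset of \<open>A\<close> this is the coheir condition;
  with \<open>A = UNIV\<close> it is ordinary finite satisfiability in \<open>M\<close>.\<close>

definition fin_sat ::
  "('f, 'r, 'a) fo_struct \<Rightarrow> nat \<Rightarrow> 'a set \<Rightarrow> (('f, 'r) fm \<times> 'a list) set \<Rightarrow> bool" where
  "fin_sat M n A p \<longleftrightarrow> (\<forall>F. finite F \<and> F \<subseteq> p \<longrightarrow> (\<exists>a. set a \<subseteq> A \<and> realizes M n a F))"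

lemma pforms_mono: "A \<subseteq> B \<Longrightarrow> pforms n A \<subseteq> pforms n B"
  by (auto simp: pforms_def)

lemma realizes_subset: "realizes M n a p \<Longrightarrow> q \<subseteq> p \<Longrightarrow> realizes M n a q"
  by (auto simp: realizes_def)

lemma fin_sat_subset: "fin_sat M n A p \<Longrightarrow> q \<subseteq> p \<Longrightarrow> fin_sat M n A q"
  by (auto simp: fin_sat_def)

lemma tp_complete_types: "tp M a A \<in> complete_types M (length a) A"
proof -
  have "\<exists>b. realizes M (length a) b F" if "F \<subseteq> tp M a A" for F
    using that by (intro exI[of _ a]) (auto simp: realizes_def tp_def)
  moreover have "(Neg \<phi>, b) \<in> pforms (length a) A" if "(\<phi>, b) \<in> pforms (length a) A"
    for \<phi> b using that by (simp add: pforms_def)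
  ultimately show ?thesis by (auto simp: complete_types_def tp_def holds_def)
qed

lemma holds_Neg: "holds M a (Neg \<phi>, b) \<longleftrightarrow> \<not> holds M a (\<phi>, b)"
  by (simp add: holds_def)

lemma pforms_Neg: "(Neg \<phi>, b) \<in> pforms n A \<longleftrightarrow> (\<phi>, b) \<in> pforms n A"
  by (simp add: pforms_def)

text \<open>Zorn's lemma gives a maximal extension that is finitely satisfiable in \<open>A\<close>.
  It is complete: if it omitted both a formula and its negation, finite parts would exclude each of
  the two on \<open>A\<close>, but every tuple satisfies one of them.\<close>

lemma fin_sat_complete_extension:
  assumes "p \<subseteq> pforms n C" and "fin_sat M n A p"
  obtains q where "p \<subseteq> q" "q \<in> complete_types M n C" "fin_sat M n A q"
proof -
  define Q where "Q = {q. p \<subseteq> q \<and> q \<subseteq> pforms n C \<and> fin_sat M n A q}"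
  have "\<exists>q\<in>Q. \<forall>X\<in>Q. q \<subseteq> X \<longrightarrow> X = q"
  proof (rule subset_Zorn_nonempty)
    show "Q \<noteq> {}" using assms by (auto simp: Q_def)
    fix \<C> assume ne: "\<C> \<noteq> {}" and ch: "subset.chain Q \<C>"
    have sub: "\<C> \<subseteq> Q" using ch by (simp add: subset.chain_def)
    have "fin_sat M n A (\<Union>\<C>)"
      unfolding fin_sat_def
    proof (intro allI impI, elim conjE)
      fix F assume "finite F" "F \<subseteq> \<Union>\<C>"
      then obtain B where "B \<in> \<C>" "F \<subseteq> B"
        using finite_subset_Union_chain[OF _ _ ne ch] by blast
      then show "\<exists>a. set a \<subseteq> A \<and> realizes M n a F"
        using sub \<open>finite F\<close> by (auto simp: Q_def fin_sat_def)
    qed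
    then show "\<Union>\<C> \<in> Q" using sub ne by (auto simp: Q_def)
  qed
  then obtain q where q: "p \<subseteq> q" "q \<subseteq> pforms n C" "fin_sat M n A q"
    and max: "\<And>X. X \<in> Q \<Longrightarrow> q \<subseteq> X \<Longrightarrow> X = q"
    by (auto simp: Q_def)
  \<comment> \<open>Maximality: a formula outside \<open>q\<close> is refuted, among tuples from
    \<open>A\<close>, by a finite part of \<open>q\<close>.\<close>
  have ins: "\<exists>F. finite F \<and> F \<subseteq> q \<and>
      (\<forall>a. set a \<subseteq> A \<and> realizes M n a F \<longrightarrow> \<not> holds M a \<theta>)"
    if "\<theta> \<in> pforms n C" "\<theta> \<notin> q" for \<theta>
  proof -
    have "insert \<theta> q \<notin> Q" using max[of "insert \<theta> q"] that by auto
    then have "\<not> fin_sat M n A (insert \<theta> q)" using q that by (auto simp: Q_def)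
    then obtain F where F: "finite F" "F \<subseteq> insert \<theta> q"
        "\<And>a. set a \<subseteq> A \<Longrightarrow> \<not> realizes M n a F"
      by (auto simp: fin_sat_def)
    then show ?thesis by (intro exI[of _ "F - {\<theta>}"]) (auto simp: realizes_def)
  qed
  have "(\<phi>, b) \<in> q \<or> (Neg \<phi>, b) \<in> q" if \<phi>: "(\<phi>, b) \<in> pforms n C" for \<phi> b
  proof (rule ccontr)
    assume "\<not> ?thesis"
    then obtain F G where F: "finite F" "F \<subseteq> q"
        "\<And>a. set a \<subseteq> A \<Longrightarrow> realizes M n a F \<Longrightarrow> \<not> holds M a (\<phi>, b)"
      and G: "finite G" "G \<subseteq> q"
        "\<And>a. set a \<subseteq> A \<Longrightarrow> realizes M n a G \<Longrightarrow> \<not> holds M a (Neg \<phi>, b)"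
      using ins[of "(\<phi>, b)"] ins[of "(Neg \<phi>, b)"] \<phi> unfolding pforms_Neg by metis
    have "finite (F \<union> G)" "F \<union> G \<subseteq> q" using F G by auto
    then obtain a where "set a \<subseteq> A" "realizes M n a (F \<union> G)"
      using q(3) unfolding fin_sat_def by blast
    then show False
      using F(3)[of a] G(3)[of a] by (auto simp: holds_Neg intro: realizes_subset)
  qed
  then have "q \<in> complete_types M n C"
    using q unfolding complete_types_def fin_sat_def by blast
  with q that show ?thesis by blast
qed

lemma fin_sat_realization:
  assumes "saturated \<kappa> M" and "small \<kappa> C" and "p \<subseteq> pforms n C" and "fin_sat M n A p"
  obtains a where "realizes M n a p" "length a = n" "fin_sat M n A (tp M a C)"
proof -
  obtain q where q: "p \<subseteq> q" "q \<in> complete_types M n C" "fin_sat M n A q"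
    using fin_sat_complete_extension[OF assms(3,4)] .
  then obtain a where a: "realizes M n a q"
    using assms(1,2) unfolding saturated_def by blast
  then have len: "length a = n" by (simp add: realizes_def)
  \<comment> \<open>By completeness of \<open>q\<close>, its realization \<open>a\<close> satisfies
    no further formulas over \<open>C\<close>, so its type inherits finite satisfiability.\<close>
  have "tp M a C \<subseteq> q"
  proof
    fix \<theta> assume \<theta>: "\<theta> \<in> tp M a C"
    then have h: "holds M a \<theta>" and pf: "\<theta> \<in> pforms n C" by (auto simp: tp_def len)
    obtain \<phi> b where \<phi>: "\<theta> = (\<phi>, b)" by (cases \<theta>)
    show "\<theta> \<in> q"
    proof (rule ccontr)
      assume "\<theta> \<notin> q"
      then have "(Neg \<phi>, b) \<in> q" using q(2) pf \<phi> by (auto simp: complete_types_def)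
      then have "holds M a (Neg \<phi>, b)" using a by (auto simp: realizes_def)
      then show False using h \<phi> by (simp add: holds_Neg)
    qed
  qed
  then show ?thesis
    using that a len q fin_sat_subset realizes_subset by metis
qed

section \<open>Forking and finite satisfiability\<close>

text \<open>That \<open>m\<close> satisfies the formula with parameters \<open>b\<close> is itself
  part of the type of \<open>b\<close> over \<open>A\<close>, because \<open>m\<close> lies in
  \<open>A\<close>. Hence \<open>m\<close> is a common realization of all instances at realizations
  of this type, and no \<open>k\<close> of them are inconsistent.\<close>

lemma not_divides_if_holds:
  assumes "length m = n" and "set m \<subseteq> A" and "\<delta> \<in> pforms n B" and "holds M m \<delta>"
  shows "\<not> divides M n A \<delta>"
proof
  obtain \<phi> b where \<delta>: "\<delta> = (\<phi>, b)" by (cases \<delta>)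
  have fv: "fv \<phi> \<subseteq> {..<length m + length b}"
    using assms by (auto simp: \<delta> pforms_def)
  let ?\<theta> = "(rename (block_swap (length m) (length b)) \<phi>, m)"
  have \<theta>: "?\<theta> \<in> tp M b A"
    using assms fv fv_swap[OF fv] holds_swap[OF fv, of M]
    by (simp add: tp_def pforms_def \<delta>)
  assume "divides M n A \<delta>"
  then obtain k :: nat and c :: "nat \<Rightarrow> _" where
    c: "\<forall>i. realizes M (length b) (c i) (tp M b A)" and
    k: "\<forall>I. finite I \<and> card I = k \<longrightarrow> \<not> (\<exists>a. realizes M n a ((\<lambda>i. (\<phi>, c i)) ` I))"
    unfolding divides_def \<delta> prod.case by blast
  have "holds M m (\<phi>, c i)" for i
  proof -
    have len: "length (c i) = length b" and "holds M (c i) ?\<theta>"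
      using c \<theta> by (auto simp: realizes_def)
    then show ?thesis using holds_swap[of \<phi> m "c i" M] fv by simp
  qed
  then have "realizes M n m ((\<lambda>i. (\<phi>, c i)) ` {..<k})"
    using assms by (auto simp: realizes_def)
  moreover have "finite {..<k} \<and> card {..<k} = k" by simp
  ultimately show False using k by blast
qed

lemma small_Un_finite:
  assumes "Card_order \<kappa>" and "infinite (Field \<kappa>)" and "small \<kappa> A" and "finite B"
  shows "small \<kappa> (A \<union> B)"
proof -
  have "|B| <o \<kappa>"
    using assms finite_ordLess_infinite[of "|B|" \<kappa>]
    by (metis Field_card_of card_of_Card_order card_order_on_well_order_on)
  then show ?thesis
    using assms card_of_Un_ordLess_infinite_Field by (auto simp: small_def)
qed

text \<open>A type finitely satisfiable in \<open>A\<close> extends to a larger set of parameters without losing this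
  property, and no formula satisfied in \<open>A\<close> divides over \<open>A\<close>.\<close>

lemma fin_sat_not_forks:
  assumes "saturated \<kappa> M" and "Card_order \<kappa>" and "infinite (Field \<kappa>)" and "small \<kappa> C"
    and "p \<subseteq> pforms n C" and "fin_sat M n A p"
  shows "\<not> forks M n A p"
proof
  assume "forks M n A p"
  then obtain D where D: "finite D" "D \<subseteq> pforms n UNIV" "\<And>\<delta>. \<delta> \<in> D \<Longrightarrow> divides M n A \<delta>"
    "\<And>a. realizes M n a p \<Longrightarrow> \<exists>\<delta>\<in>D. holds M a \<delta>"
    by (auto simp: forks_def)
  \<comment> \<open>Adjoining the parameters of \<open>D\<close> puts the formula of
    \<open>D\<close> that holds of the realization into a type finitely satisfiable in
    \<open>A\<close>, so this formula also holds of a tuple from \<open>A\<close>.\<close>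
  define C' where "C' = C \<union> (\<Union>\<delta>\<in>D. set (snd \<delta>))"
  have "small \<kappa> C'"
    unfolding C'_def using assms D by (intro small_Un_finite) auto
  moreover have "p \<subseteq> pforms n C'"
    using assms pforms_mono[of C C' n] by (auto simp: C'_def)
  ultimately obtain a where a: "realizes M n a p" "length a = n" "fin_sat M n A (tp M a C')"
    using assms fin_sat_realization by metis
  obtain \<delta> where \<delta>: "\<delta> \<in> D" "holds M a \<delta>" using D a by blast
  have "\<delta> \<in> pforms n C'"
    using \<delta>(1) D(2) by (force simp: pforms_def C'_def)
  then have "{\<delta>} \<subseteq> tp M a C'" using \<delta> a by (simp add: tp_def)
  then obtain m where "set m \<subseteq> A" "realizes M n m {\<delta>}"
    using a(3) unfolding fin_sat_def by (meson finite.emptyI finite_insert)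
  then have "\<not> divides M n A \<delta>"
    using \<delta> D by (intro not_divides_if_holds[of m _ _ _ UNIV]) (auto simp: realizes_def)
  then show False using D \<delta> by blast
qed

section \<open>Small elementary submodels\<close>

lemma finite_ordLeq_infinite: "finite A \<Longrightarrow> infinite B \<Longrightarrow> |A| \<le>o |B|"
  by (intro ordLess_imp_ordLeq finite_ordLess_infinite)
    (simp_all add: Field_card_of card_of_well_order_on)

lemma card_of_lists_ordLeq_infinite:
  assumes "infinite B" and "|A| \<le>o |B|"
  shows "|lists A| \<le>o |B|"
proof -
  have "|{xs \<in> lists A. length xs = n}| \<le>o |B|" for n
  proof (induction n)
    case 0
    have "finite {xs \<in> lists A. length xs = 0}" by simp
    then show ?case using assms(1) by (rule finite_ordLeq_infinite)
  next
    case (Suc n)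
    have "{xs \<in> lists A. length xs = Suc n}
        \<subseteq> (\<lambda>(x, xs). x # xs) ` (A \<times> {xs \<in> lists A. length xs = n})"
      by (auto simp: length_Suc_conv image_iff)
    then have "|{xs \<in> lists A. length xs = Suc n}| \<le>o |A \<times> {xs \<in> lists A. length xs = n}|"
      by (meson card_of_mono1 card_of_image ordLeq_transitive)
    moreover have "|A \<times> {xs \<in> lists A. length xs = n}| \<le>o |B|"
      using assms Suc by (intro card_of_Times_ordLeq_infinite_Field) (simp_all add: Field_card_of card_of_card_order_on)
    ultimately show ?case using ordLeq_transitive by blast
  qed
  moreover have "|UNIV :: nat set| \<le>o |B|" using assms infinite_iff_card_of_nat by blast
  ultimately have "|\<Union>n. {xs \<in> lists A. length xs = n}| \<le>o |B|"
    using assms(1) by (intro card_of_UNION_ordLeq_infinite) auto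
  moreover have "(\<Union>n. {xs \<in> lists A. length xs = n}) = lists A" by auto
  ultimately show ?thesis by simp
qed

lemma infinite_fm: "infinite (UNIV :: ('f, 'r) fm set)"
proof -
  have "inj (\<lambda>n. Eq (Var n) (Var n) :: ('f, 'r) fm)" by (auto simp: inj_def)
  then show ?thesis by (rule infinite_super[OF subset_UNIV range_inj_infinite])
qed

lemma card_of_pforms:
  fixes X :: "'a set"
  assumes "|X| \<le>o |UNIV :: ('f, 'r) fm set|"
  shows "|pforms n X :: (('f, 'r) fm \<times> 'a list) set| \<le>o |UNIV :: ('f, 'r) fm set|"
proof -
  have "|(UNIV :: ('f, 'r) fm set) \<times> lists X| \<le>o |UNIV :: ('f, 'r) fm set|"
    using assms
    by (intro card_of_Times_ordLeq_infinite_Field card_of_lists_ordLeq_infinite)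
      (simp_all add: infinite_fm Field_card_of card_of_card_order_on card_of_mono1)
  moreover have "(pforms n X :: (('f, 'r) fm \<times> 'a list) set) \<subseteq> UNIV \<times> lists X"
    by (auto simp: pforms_def)
  ultimately show ?thesis using card_of_mono1 ordLeq_transitive by blast
qed

text \<open>\<open>X\<close> is closed in countably many steps under chosen realizations. The last
  conclusion is the Tarski-Vaught criterion in terms of types: \<open>A\<close> is an elementary
  submodel, and every type over \<open>A\<close> is a coheir of itself.\<close>

lemma Loewenheim_Skolem:
  fixes M :: "('f, 'r, 'a) fo_struct" and X :: "'a set"
  assumes "|X| \<le>o |UNIV :: ('f, 'r) fm set|"
  obtains A where "X \<subseteq> A" "|A| \<le>o |UNIV :: ('f, 'r) fm set|"
    "\<And>a. fin_sat M (length a) A (tp M a A)"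
proof -
  let ?L = "UNIV :: ('f, 'r) fm set"
  \<comment> \<open>Finite sets of formulas are listed, so that the cardinality bound for lists
    applies. If \<open>ps\<close> has no realization, the chosen tuple is arbitrary and merely adds
    finitely many elements.\<close>
  define sk where "sk n ps = (SOME a. realizes M n a (set ps))"
    for n and ps :: "(('f, 'r) fm \<times> 'a list) list"
  define step where "step Y = Y \<union> (\<Union>n. \<Union>ps\<in>lists (pforms n Y). set (sk n ps))" for Y
  define Y where "Y k = (step ^^ k) X" for k
  have Y_Suc: "Y (Suc k) = step (Y k)" for k by (simp add: Y_def)
  have nat: "|UNIV :: nat set| \<le>o |?L|" using infinite_fm infinite_iff_card_of_nat by blast
  have fin: "|Z| \<le>o |?L|" if "finite Z" for Z :: "'a set"
    using that infinite_fm by (intro finite_ordLeq_infinite) auto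
  have card: "|Y k| \<le>o |?L|" for k
  proof (induction k)
    case 0 then show ?case using assms by (simp add: Y_def)
  next
    case (Suc k)
    have "|\<Union>n. \<Union>ps\<in>lists (pforms n (Y k)). set (sk n ps)| \<le>o |?L|"
      using nat fin infinite_fm Suc
      by (intro card_of_UNION_ordLeq_infinite ballI card_of_lists_ordLeq_infinite card_of_pforms)
        auto
    then show ?case
      unfolding Y_Suc step_def using Suc infinite_fm
      by (intro card_of_Un_ordLeq_infinite_Field) (simp_all add: Field_card_of card_of_card_order_on)
  qed
  have mono: "Y i \<subseteq> Y j" if "i \<le> j" for i j
    using that by (rule lift_Suc_mono_le[rotated]) (auto simp: Y_Suc step_def)
  have fin_Y: "\<exists>k. Z \<subseteq> Y k" if "finite Z" "Z \<subseteq> (\<Union>k. Y k)" for Z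
    using that
  proof (induction rule: finite_induct)
    case (insert z Z)
    then obtain i j where ij: "Z \<subseteq> Y i" "z \<in> Y j" by blast
    have "insert z Z \<subseteq> Y (max i j)"
      using ij mono[of i "max i j"] mono[of j "max i j"] by auto
    then show ?case by blast
  qed auto
  let ?A = "\<Union>k. Y k"
  show ?thesis
  proof
    show "X \<subseteq> ?A" using UN_upper[of 0 UNIV Y] by (simp add: Y_def)
    show "|?A| \<le>o |?L|"
      using card nat infinite_fm by (intro card_of_UNION_ordLeq_infinite) auto
    fix a
    show "fin_sat M (length a) ?A (tp M a ?A)"
      unfolding fin_sat_def
    proof (intro allI impI, elim conjE)
      fix F assume "finite F" and F: "F \<subseteq> tp M a ?A"
      then obtain ps where ps: "set ps = F" using finite_list by blast
      have "finite (\<Union>\<theta>\<in>F. set (snd \<theta>))" using \<open>finite F\<close> by auto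
      moreover have "(\<Union>\<theta>\<in>F. set (snd \<theta>)) \<subseteq> (\<Union>k. Y k)"
        using F by (fastforce simp: tp_def pforms_def)
      \<comment> \<open>Finitely many parameters already occur at one stage, so the next stage
        contains a realization of \<open>F\<close>.\<close>
      ultimately obtain k where k: "(\<Union>\<theta>\<in>F. set (snd \<theta>)) \<subseteq> Y k"
        using fin_Y by blast
      then have "ps \<in> lists (pforms (length a) (Y k))"
        using F ps by (fastforce simp: tp_def pforms_def in_lists_conv_set)
      then have "set (sk (length a) ps) \<subseteq> Y (Suc k)" by (auto simp: Y_Suc step_def)
      moreover have "realizes M (length a) a (set ps)"
        using F ps by (auto simp: realizes_def tp_def)
      then have "realizes M (length a) (sk (length a) ps) F"
        unfolding sk_def ps[symmetric] by (rule someI)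
      ultimately show "\<exists>a'. set a' \<subseteq> ?A \<and> realizes M (length a) a' F" by blast
    qed
  qed
qed

section \<open>Definable pairing functions\<close>

text \<open>Reads \<open>y\<close> as a stream \<open>g x0 (g x1 (g x2 ...))\<close> and says that
  \<open>x\<close> is its entry number \<open>i\<close>. A relation, since \<open>g\<close> need not
  be onto and \<open>y\<close> may have no such entry.\<close>

primrec decode :: "('a \<Rightarrow> 'a \<Rightarrow> 'a) \<Rightarrow> nat \<Rightarrow> 'a \<Rightarrow> 'a \<Rightarrow> bool" where
  "decode g 0 y x \<longleftrightarrow> (\<exists>v. y = g x v)"
| "decode g (Suc i) y x \<longleftrightarrow> (\<exists>u v. y = g u v \<and> decode g i v x)"

text \<open>The right-hand side has the form that a sentence built from \<open>Neg\<close>,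
  \<open>Conj\<close> and \<open>Exists\<close> expresses directly; compare
  \<open>pairing_sentence\<close>.\<close>

lemma inj_case_prod: "inj (case_prod h) \<longleftrightarrow>
    \<not> (\<exists>x y z w. h x y = h z w \<and> \<not> (x = z \<and> y = w))"
  unfolding inj_def split_paired_All prod.case prod.inject by blast

lemma decode_unique:
  assumes "inj (case_prod g)"
  shows "decode g i y x \<Longrightarrow> decode g i y x' \<Longrightarrow> x = x'"
proof -
  have g: "u = u' \<and> v = v'" if "g u v = g u' v'" for u v u' v'
    using assms that unfolding inj_case_prod by blast
  show "decode g i y x \<Longrightarrow> decode g i y x' \<Longrightarrow> x = x'"
  proof (induction i arbitrary: y)
    case 0
    from 0(1) obtain v where "y = g x v" by auto
    moreover from 0(2) obtain v' where "y = g x' v'" by auto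
    ultimately show ?case using g[of x v x' v'] by simp
  next
    case (Suc i)
    from Suc.prems(1) obtain u v where "y = g u v" "decode g i v x" by auto
    moreover from Suc.prems(2) obtain u' v' where "y = g u' v'" "decode g i v' x'" by auto
    ultimately show ?case using g[of u v u' v'] Suc.IH[of v] by simp
  qed
qed

lemma ex_decode: "\<exists>y. \<forall>i<n. decode g i y (x i)"
proof (induction n arbitrary: x)
  case (Suc n)
  obtain y where y: "\<forall>i<n. decode g i y (x (Suc i))" using Suc[of "x \<circ> Suc"] by auto
  have "decode g i (g (x 0) y) (x i)" if "i < Suc n" for i
    using that y by (cases i) auto
  then show ?case by blast
qed simp

text \<open>In \<open>\<Gamma>\<close>, the variables \<open>0, 3, 4\<close> stand for a pair and its components, and \<open>2\<close> for a parameter;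
  in the result, \<open>1\<close> stands for the decoded element.\<close>

primrec decode_fm :: "('f, 'r) fm \<Rightarrow> nat \<Rightarrow> ('f, 'r) fm" where
  "decode_fm \<Gamma> 0 = Exists 3 (Exists 4 (Conj \<Gamma> (Eq (Var 3) (Var 1))))"
| "decode_fm \<Gamma> (Suc i) =
     Exists 3 (Exists 4 (Conj \<Gamma> (Exists 0 (Conj (Eq (Var 0) (Var 4)) (decode_fm \<Gamma> i)))))"

lemma fv_decode_fm: "fv \<Gamma> \<subseteq> {0, 2, 3, 4} \<Longrightarrow> fv (decode_fm \<Gamma> i) \<subseteq> {0, 1, 2}"
  by (induction i) auto

text \<open>Binding variable 0 anew and equating it with variable 4 replaces substitution: the
  second component becomes the element to be decoded. Variable 2 is never bound, so the condition on
  \<open>s 2\<close> survives the induction.\<close>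

lemma sat_decode_fm:
  assumes "\<And>s. s 2 = c \<Longrightarrow> sat M s \<Gamma> \<longleftrightarrow> s 0 = g (s 3) (s 4)"
  shows "s 2 = c \<Longrightarrow> sat M s (decode_fm \<Gamma> i) \<longleftrightarrow> decode g i (s 0) (s 1)"
  by (induction i arbitrary: s) (auto simp: assms)

lemma range_case_nat: "range (case_nat c f) = insert c (range f)"
  by (auto simp: image_iff split: nat.split) metis+

text \<open>A finite cardinality \<open>n \<ge> 2\<close> has \<open>n * n > n\<close>.\<close>

lemma inj_pairing_infinite:
  fixes g :: "'a \<Rightarrow> 'a \<Rightarrow> 'a"
  assumes "inj (case_prod g)" and "(x :: 'a) \<noteq> y"
  shows "infinite (UNIV :: 'a set)"
proof
  assume fin: "finite (UNIV :: 'a set)"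
  have "card (UNIV :: ('a \<times> 'a) set) \<le> card (UNIV :: 'a set)"
    using assms(1) fin by (intro card_inj_on_le) auto
  then have "card (UNIV :: 'a set) * card (UNIV :: 'a set) \<le> card (UNIV :: 'a set)"
    by (simp add: card_cartesian_product flip: UNIV_Times_UNIV)
  moreover have "card {x, y} \<le> card (UNIV :: 'a set)" using fin by (intro card_mono) auto
  ultimately show False using assms(2) by simp
qed

section \<open>Coheir sequences\<close>

text \<open>A type over \<open>A\<close> that is finitely satisfiable in \<open>A\<close> but not
  realized there is realized again and again, each time by a coheir over the elements found
  before.\<close>

lemma ex_coheir_sequence:
  fixes M :: "('f, 'r, 'a) fo_struct" and A :: "'a set"
  assumes "saturated \<kappa> M" and "Card_order \<kappa>" and "infinite (Field \<kappa>)"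
    and "small \<kappa> A" and "infinite A"
  obtains x :: "nat \<Rightarrow> 'a" where "inj x" "\<And>i j. realizes M 1 [x j] (tp M [x i] A)"
    "\<And>i. fin_sat M 1 A (tp M [x i] (A \<union> x ` {..<i}))"
proof -
  \<comment> \<open>Says that the variable differs from every element of \<open>A\<close>; finitely
    satisfiable in \<open>A\<close> because \<open>A\<close> is infinite.\<close>
  let ?q = "(\<lambda>m. (Neg (Eq (Var 0) (Var 1)), [m])) ` A :: (('f, 'r) fm \<times> 'a list) set"
  have q_pf: "?q \<subseteq> pforms 1 A" by (auto simp: pforms_def)
  have "fin_sat M 1 A ?q"
    unfolding fin_sat_def
  proof (intro allI impI, elim conjE)
    fix F assume "finite F" "F \<subseteq> ?q"
    then obtain S where S: "S \<subseteq> A" "finite S" "F = (\<lambda>m. (Neg (Eq (Var 0) (Var 1)), [m])) ` S"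
      by (meson finite_subset_image)
    obtain m where "m \<in> A" "m \<notin> S"
      using S(2) assms(5) by (meson finite_subset subsetI)
    then show "\<exists>a. set a \<subseteq> A \<and> realizes M 1 a F"
      by (intro exI[of _ "[m]"]) (auto simp: S realizes_def holds_def)
  qed
  then obtain z where z: "realizes M 1 z ?q" "length z = 1" "fin_sat M 1 A (tp M z A)"
    using fin_sat_realization[OF assms(1,4) q_pf] by blast
  have tz: "?q \<subseteq> tp M z A" using z q_pf by (auto simp: tp_def realizes_def)
  have tz_pf: "tp M z A \<subseteq> pforms 1 A" using z by (auto simp: tp_def)
  \<comment> \<open>\<open>P x i r\<close> depends on \<open>x\<close> only below \<open>i\<close>,
    as the recursive choice requires.\<close>
  define P where "P x i r \<longleftrightarrow>
      realizes M 1 [r] (tp M z A) \<and> fin_sat M 1 A (tp M [r] (A \<union> x ` {..<i}))"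
    for x :: "nat \<Rightarrow> 'a" and i r
  have "\<exists>x. \<forall>i. P x i (x i)"
  proof (rule dependent_wellorder_choice)
    fix r and f g :: "nat \<Rightarrow> 'a" and i :: nat
    assume "\<And>y. y < i \<Longrightarrow> f y = g y"
    then have "f ` {..<i} = g ` {..<i}" by auto
    then show "P f i r = P g i r" by (simp only: P_def)
  next
    fix i :: nat and f :: "nat \<Rightarrow> 'a"
    have "small \<kappa> (A \<union> f ` {..<i})" using assms by (intro small_Un_finite) auto
    then obtain a where a: "realizes M 1 a (tp M z A)" "length a = 1"
        "fin_sat M 1 A (tp M a (A \<union> f ` {..<i}))"
      using fin_sat_realization[OF assms(1) _ _ z(3), of "A \<union> f ` {..<i}"] tz_pf
        pforms_mono[of A "A \<union> f ` {..<i}" 1] by auto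
    then obtain r where "a = [r]" by (auto simp: length_Suc_conv)
    with a show "\<exists>r. P f i r" by (auto simp: P_def)
  qed
  then obtain x :: "nat \<Rightarrow> 'a" where x: "\<And>i. realizes M 1 [x i] (tp M z A)"
      "\<And>i. fin_sat M 1 A (tp M [x i] (A \<union> x ` {..<i}))"
    unfolding P_def by blast
  \<comment> \<open>The type of \<open>z\<close> over \<open>A\<close> is complete, so all
    \<open>x i\<close> have this same type over \<open>A\<close>.\<close>
  have tp_x: "tp M [x i] A \<subseteq> tp M z A" for i
  proof
    fix \<theta> assume \<theta>: "\<theta> \<in> tp M [x i] A"
    obtain \<phi> b where \<phi>: "\<theta> = (\<phi>, b)" by (cases \<theta>)
    show "\<theta> \<in> tp M z A"
    proof (rule ccontr)
      assume "\<theta> \<notin> tp M z A"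
      then have "(Neg \<phi>, b) \<in> tp M z A"
        using \<theta> \<phi> z(2) by (auto simp: tp_def pforms_Neg holds_Neg)
      then have "holds M [x i] (Neg \<phi>, b)" using x(1)[of i] by (auto simp: realizes_def)
      then show False using \<theta> \<phi> by (simp add: tp_def holds_Neg)
    qed
  qed
  have x_A: "x i \<notin> A" for i
  proof
    assume "x i \<in> A"
    then have "holds M [x i] (Neg (Eq (Var 0) (Var 1)), [x i])"
      using tz x(1)[of i] by (auto simp: realizes_def)
    then show False by (simp add: holds_def)
  qed
  \<comment> \<open>Otherwise equality with \<open>x j\<close> would belong to the coheir type of
    \<open>x i\<close> and be satisfied in \<open>A\<close>, placing \<open>x j\<close> in
    \<open>A\<close>.\<close>
  have "x i \<noteq> x j" if "j < i" for i j
  proof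
    assume eq: "x i = x j"
    have "{(Eq (Var 0) (Var 1), [x j])} \<subseteq> tp M [x i] (A \<union> x ` {..<i})"
      using that by (auto simp: tp_def pforms_def holds_def eq)
    then obtain m where "set m \<subseteq> A" "realizes M 1 m {(Eq (Var 0) (Var 1), [x j])}"
      using x(2)[of i] unfolding fin_sat_def by (meson finite.emptyI finite_insert)
    then have "x j \<in> A" by (auto simp: realizes_def holds_def length_Suc_conv)
    then show False using x_A by blast
  qed
  then have "inj x" by (metis linorder_neqE_nat injI)
  moreover have "realizes M 1 [x j] (tp M [x i] A)" for i j
    using x(1)[of j] tp_x[of i] by (rule realizes_subset)
  ultimately show ?thesis using x(2) by (rule that)
qed

section \<open>Infinite weight from a definable pairing\<close>

theorem definable_pairing_infinite_weight:
  fixes M :: "('f, 'r, 'a) fo_struct" and g :: "'a \<Rightarrow> 'a \<Rightarrow> 'a"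
  assumes mon: "monster_model \<kappa> T M"
    and inj: "inj (case_prod g)" and two: "u \<noteq> (v :: 'a)"
    and fv: "fv \<Gamma> \<subseteq> {0, 2, 3, 4}"
    and \<Gamma>: "\<And>s. s 2 = c \<Longrightarrow> sat M s \<Gamma> \<longleftrightarrow> s 0 = g (s 3) (s 4)"
  obtains A p where "small \<kappa> A" "p \<in> complete_types M 1 A" "weight \<kappa> M 1 A p = \<infinity>"
proof -
  let ?L = "UNIV :: ('f, 'r) fm set"
  have sat: "saturated \<kappa> M" and co: "Card_order \<kappa>" and L: "|?L| <o \<kappa>"
    using mon by (auto simp: monster_model_def)
  have inf: "infinite (Field \<kappa>)"
    using L co infinite_fm by (metis Card_order_iff_ordLeq_card_of card_of_ordLeq_infinite
        ordLess_imp_ordLeq ordLeq_transitive)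
  have small: "small \<kappa> X" if "|X| \<le>o |?L|" for X :: "'a set"
    using that L ordLeq_ordLess_trans by (auto simp: small_def)
  have ctbl: "|range f| \<le>o |?L|" for f :: "nat \<Rightarrow> 'a"
    using card_of_image ordLeq_transitive infinite_fm infinite_iff_card_of_nat by blast
  \<comment> \<open>The range of \<open>e\<close> serves to make the submodel \<open>A\<close>
    infinite; \<open>c\<close> is put into \<open>A\<close> so that the pairing is definable over
    \<open>A\<close>.\<close>
  obtain e :: "nat \<Rightarrow> 'a" where e: "inj e"
    using inj_pairing_infinite[OF inj two] infinite_countable_subset by blast
  have "|insert c (range e)| \<le>o |?L|"
    using ctbl[of "case_nat c e"] by (simp add: range_case_nat)
  then obtain A where A: "insert c (range e) \<subseteq> A" "|A| \<le>o |?L|"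
      "\<And>a. fin_sat M (length a) A (tp M a A)"
    using Loewenheim_Skolem[of "insert c (range e)" M] by metis
  have c: "c \<in> A" using A(1) by simp
  have "infinite A" using e A(1) by (meson finite_subset insert_subset range_inj_infinite)
  then obtain x :: "nat \<Rightarrow> 'a" where x: "inj x" "\<And>i j. realizes M 1 [x j] (tp M [x i] A)"
      "\<And>i. fin_sat M 1 A (tp M [x i] (A \<union> x ` {..<i}))"
    using ex_coheir_sequence[OF sat co inf small[OF A(2)]] by metis

  \<comment> \<open>The parameters \<open>[z, c]\<close> follow the single object variable, so they
    fill variables 1 and 2 of \<open>decode_fm\<close>.\<close>
  define \<theta> where "\<theta> i z = (decode_fm \<Gamma> i, [z, c])" for i z
  have holds: "holds M [y] (\<theta> i z) \<longleftrightarrow> decode g i y z" for i y z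
    using sat_decode_fm[of c M \<Gamma> g "\<lambda>i. [y, z, c] ! i" i] \<Gamma> by (simp add: holds_def \<theta>_def)
  have pf: "\<theta> i z \<in> pforms 1 B" if "z \<in> B" "c \<in> B" for i z B
    using fv_decode_fm[OF fv, of i] that by (auto simp: pforms_def \<theta>_def)
  \<comment> \<open>Finitely many entries can be prescribed by nesting \<open>g\<close>; saturation
    over the small set \<open>?C\<close> then yields one \<open>y\<close> coding the whole
    sequence.\<close>
  let ?C = "insert c (range x)"
  have "small \<kappa> ?C"
    using ctbl[of "case_nat c x"] by (intro small) (simp add: range_case_nat)
  moreover have "range (\<lambda>i. \<theta> i (x i)) \<subseteq> pforms 1 ?C"
    by (intro image_subsetI pf) auto
  moreover have "fin_sat M 1 UNIV (range (\<lambda>i. \<theta> i (x i)))"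
    unfolding fin_sat_def
  proof (intro allI impI, elim conjE)
    fix F assume "finite F" "F \<subseteq> range (\<lambda>i. \<theta> i (x i))"
    then obtain I where I: "finite I" "F = (\<lambda>i. \<theta> i (x i)) ` I"
      by (meson finite_subset_image)
    then obtain n where n: "\<And>i. i \<in> I \<Longrightarrow> i < n"
      using finite_nat_set_iff_bounded[of I] by blast
    obtain y where "\<forall>i<n. decode g i y (x i)" using ex_decode[of n g x] by blast
    then show "\<exists>a. set a \<subseteq> UNIV \<and> realizes M 1 a F"
      using n by (intro exI[of _ "[y]"]) (auto simp: I realizes_def holds)
  qed
  ultimately obtain a where a: "realizes M 1 a (range (\<lambda>i. \<theta> i (x i)))" "length a = 1"
    using fin_sat_realization[OF sat] by metis
  then obtain y where "a = [y]" by (auto simp: length_Suc_conv)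
  with a have y: "decode g i y (x i)" for i by (auto simp: realizes_def holds)

  \<comment> \<open>Witnessed by \<open>k = 2\<close> and the tuples \<open>[x j, c]\<close>: no
    element has two different entries at the same position.\<close>
  have div: "divides M 1 A (\<theta> i (x i))" for i
    unfolding divides_def \<theta>_def prod.case
  proof (intro exI[of _ 2] exI[of _ "\<lambda>j. [x j, c]"] conjI allI impI)
    fix j
    have "holds M [x j, c] (\<phi>, b)" if "(\<phi>, b) \<in> tp M [x i, c] A" for \<phi> b
    proof -
      \<comment> \<open>As \<open>c\<close> lies in \<open>A\<close>, it can pass from the tuple to
        the parameters, which reduces the claim to the types of \<open>x i\<close> and
        \<open>x j\<close>.\<close>
      have "(\<phi>, c # b) \<in> tp M [x i] A"
        using that c by (auto simp: tp_def pforms_def holds_def)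
      then show ?thesis using x(2)[of j i] by (auto simp: realizes_def holds_def)
    qed
    then show "realizes M (length [x i, c]) [x j, c] (tp M [x i, c] A)"
      by (auto simp: realizes_def)
  next
    fix I :: "nat set" assume "finite I \<and> card I = 2"
    then obtain j k where jk: "I = {j, k}" "j \<noteq> k" by (auto simp: card_2_iff)
    show "\<not> (\<exists>a. realizes M 1 a ((\<lambda>j. (decode_fm \<Gamma> i, [x j, c])) ` I))"
    proof
      assume "\<exists>a. realizes M 1 a ((\<lambda>j. (decode_fm \<Gamma> i, [x j, c])) ` I)"
      then obtain z where "holds M [z] (\<theta> i (x j))" "holds M [z] (\<theta> i (x k))"
        by (auto simp: realizes_def jk \<theta>_def length_Suc_conv)
      then have "x j = x k" using decode_unique[OF inj] by (auto simp: holds)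
      then show False using x(1) jk(2) by (auto dest: injD)
    qed
  qed
  have dep: "\<not> indep M [y] A (set [x i])" for i
  proof -
    have "\<theta> i (x i) \<in> tp M [y] (A \<union> {x i})"
      using c pf[of "x i" "A \<union> {x i}" i] by (simp add: tp_def holds y)
    moreover have "\<theta> i (x i) \<in> pforms 1 UNIV" by (rule pf) auto
    ultimately show ?thesis
      using div[of i] unfolding indep_def forks_def
      by (auto intro!: exI[of _ "{\<theta> i (x i)}"] simp: realizes_def)
  qed
  have indep: "indep M [x i] A (\<Union>j<i. set [x j])" for i
  proof -
    have "small \<kappa> (A \<union> x ` {..<i})"
      using small[OF A(2)] by (intro small_Un_finite co inf) auto
    then have "\<not> forks M 1 A (tp M [x i] (A \<union> x ` {..<i}))"
      by (rule fin_sat_not_forks[OF sat co inf _ _ x(3)]) (auto simp: tp_def)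
    moreover have "x ` {..<i} = (\<Union>j<i. set [x j])" by auto
    ultimately show ?thesis by (simp add: indep_def)
  qed
  \<comment> \<open>Since \<open>A\<close> is an elementary submodel, the type of \<open>y\<close>
    over \<open>A\<close> is finitely satisfiable in \<open>A\<close>.\<close>
  have "\<not> forks M 1 A (tp M [y] A)"
    using A(3)[of "[y]"] by (intro fin_sat_not_forks[OF sat co inf small[OF A(2)]])
      (auto simp: tp_def)
  \<comment> \<open>The weight is witnessed with \<open>B = A\<close> and the entire sequence, of
    length \<open>\<infinity>\<close>.\<close>
  then have "\<infinity> \<le> weight \<kappa> M 1 A (tp M [y] A)"
    unfolding weight_def using small[OF A(2)] dep indep
    by (intro Sup_upper CollectI exI[of _ A] exI[of _ "[y]"] exI[of _ "\<lambda>i. [x i]"])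
      (auto simp: indep_seq_def)
  then have "weight \<kappa> M 1 A (tp M [y] A) = \<infinity>" by simp
  then show ?thesis
    using that[OF small[OF A(2)], of "tp M [y] A"] tp_complete_types[of M "[y]" A] by simp
qed

section \<open>Imperfect fields\<close>

primrec pow_tm :: "nat \<Rightarrow> ring_sym tm \<Rightarrow> ring_sym tm" where
  "pow_tm 0 t = Fun ROne []"
| "pow_tm (Suc n) t = Fun RMul [t, pow_tm n t]"

definition pair_tm :: "nat \<Rightarrow> nat \<Rightarrow> nat \<Rightarrow> nat \<Rightarrow> ring_sym tm" where
  "pair_tm n i j k = Fun RAdd [pow_tm n (Var j), Fun RMul [Var i, pow_tm n (Var k)]]"

text \<open>Defined by evaluating a term, because \<open>M\<close> is only elementarily equivalent
  to the field and its universe carries no field operations as a type.\<close>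

definition pairing ::
  "(ring_sym, 'r, 'a) fo_struct \<Rightarrow> nat \<Rightarrow> 'a \<Rightarrow> 'a \<Rightarrow> 'a \<Rightarrow> 'a" where
  "pairing M n a x y = eval_tm M (\<lambda>i. [a, x, y] ! i) (pair_tm n 0 1 2)"

lemma eval_pow_tm:
  "eval_tm M s t = eval_tm M s' t' \<Longrightarrow> eval_tm M s (pow_tm n t) = eval_tm M s' (pow_tm n t')"
  by (induction n) auto

lemma eval_pair_tm: "eval_tm M s (pair_tm n i j k) = pairing M n (s i) (s j) (s k)"
proof -
  have "eval_tm M s (pow_tm n (Var j)) = eval_tm M (\<lambda>m. [s i, s j, s k] ! m) (pow_tm n (Var 1))"
    and "eval_tm M s (pow_tm n (Var k)) = eval_tm M (\<lambda>m. [s i, s j, s k] ! m) (pow_tm n (Var 2))"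
    by (rule eval_pow_tm, simp)+
  then show ?thesis by (simp add: pairing_def pair_tm_def)
qed

lemma fv_pow_tm: "fv_tm (pow_tm n t) \<subseteq> fv_tm t"
  by (induction n) auto

lemma fv_pair_tm: "fv_tm (pair_tm n i j k) \<subseteq> {i, j, k}"
  using fv_pow_tm[of n "Var j"] fv_pow_tm[of n "Var k"] by (auto simp: pair_tm_def)

lemma eval_pow_tm_field:
  "eval_tm (field_struct R) s (pow_tm n t) = eval_tm (field_struct R) s t ^ n"
  by (induction n) (auto simp: field_struct_def)

lemma pairing_field: "pairing (field_struct R) n a x y = x ^ n + a * y ^ n"
  by (simp add: pairing_def pair_tm_def eval_pow_tm_field) (simp add: field_struct_def)

text \<open>Carries the pairing from the field over to \<open>M\<close>. The parameter, variable 0,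
  is quantified because the field element \<open>a\<close> does not belong to \<open>M\<close>; the
  existence of two elements is included for \<open>inj_pairing_infinite\<close>.\<close>

definition pairing_sentence :: "nat \<Rightarrow> (ring_sym, 'r) fm" where
  "pairing_sentence n =
     Exists 0 (Conj (Exists 1 (Exists 2 (Neg (Eq (Var 1) (Var 2)))))
       (Neg (Exists 1 (Exists 2 (Exists 3 (Exists 4
         (Conj (Eq (pair_tm n 0 1 2) (pair_tm n 0 3 4))
           (Neg (Conj (Eq (Var 1) (Var 3)) (Eq (Var 2) (Var 4)))))))))))"

lemma fv_pairing_sentence: "fv (pairing_sentence n) = {}"
  using fv_pair_tm[of n 0 1 2] fv_pair_tm[of n 0 3 4] by (auto simp: pairing_sentence_def)

lemma sat_pairing_sentence:
  fixes M :: "(ring_sym, 'r, 'a) fo_struct"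
  shows "sat M s (pairing_sentence n) \<longleftrightarrow>
     (\<exists>a. (\<exists>x y :: 'a. x \<noteq> y) \<and> inj (case_prod (pairing M n a)))"
  unfolding inj_case_prod by (simp add: pairing_sentence_def eval_pair_tm)

text \<open>Since the Frobenius map is additive, two representations of the same element as
  \<open>x ^ p + a * y ^ p\<close> with different \<open>y\<close> would make \<open>a\<close> a \<open>p\<close>-th power.\<close>

lemma inj_frobenius_pairing:
  fixes a :: "'k::field"
  assumes "CHAR('k) > 0" and "\<And>y. y ^ CHAR('k) \<noteq> a"
  shows "inj (\<lambda>(x, y). x ^ CHAR('k) + a * y ^ CHAR('k))"
proof -
  let ?p = "CHAR('k)"
  have p: "prime ?p" using assms(1) prime_CHAR_semidom by blast
  have diff: "(x - z) ^ ?p = x ^ ?p - z ^ ?p" for x z :: 'k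
    using freshmans_dream[OF p refl, of "x - z" z] by simp
  have *: "x = z \<and> y = w" if eq: "x ^ ?p + a * y ^ ?p = z ^ ?p + a * w ^ ?p" for x y z w :: 'k
  proof -
    have "(x - z) ^ ?p = a * (w - y) ^ ?p" using eq by (simp add: diff algebra_simps)
    moreover have "w = y"
    proof (rule ccontr)
      assume "w \<noteq> y"
      then have "((x - z) / (w - y)) ^ ?p = a" using calculation by (simp add: power_divide)
      then show False using assms(2) by blast
    qed
    ultimately show ?thesis using assms(1) by (simp add: power_0_left)
  qed
  show ?thesis unfolding inj_case_prod using * by blast
qed

theorem proposition3p3:
  fixes R :: "'r \<Rightarrow> 'k::field list \<Rightarrow> bool"
    and M :: "(ring_sym, 'r, 'm) fo_struct"
    and \<kappa> :: "'c rel"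
  assumes "infinite (UNIV :: 'k set)"
    and "monster_model \<kappa> (Th (field_struct R)) M"
    and "strongly_stable \<kappa> M"
  shows "perfect_field TYPE('k)"
proof (rule ccontr)
  let ?p = "CHAR('k)"
  assume "\<not> perfect_field TYPE('k)"
  then obtain a :: 'k where "?p > 0" "\<And>y. y ^ ?p \<noteq> a"
    by (auto simp: perfect_field_def)
  moreover have "case_prod (pairing (field_struct R) ?p a) = (\<lambda>(x, y). x ^ ?p + a * y ^ ?p)"
    by (auto simp: pairing_field)
  ultimately have "inj (case_prod (pairing (field_struct R) ?p a))"
    using inj_frobenius_pairing by metis
  then have "sat (field_struct R) s (pairing_sentence ?p)" for s
    unfolding sat_pairing_sentence
    using zero_neq_one[where 'a = 'k] by blast
  then have "pairing_sentence ?p \<in> Th (field_struct R)"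
    by (simp add: Th_def fv_pairing_sentence)
  then have "pairing_sentence ?p \<in> Th M"
    using assms(2) by (simp add: monster_model_def)
  \<comment> \<open>In \<open>M\<close>, the witness \<open>c\<close> of the sentence takes over the
    role of \<open>a\<close>.\<close>
  then obtain c u v where c: "u \<noteq> (v :: 'm)" "inj (case_prod (pairing M ?p c))"
    by (auto simp: Th_def sat_pairing_sentence)
  \<comment> \<open>The graph of the pairing in the variable numbering that \<open>decode_fm\<close>
    expects.\<close>
  define \<Gamma> :: "(ring_sym, 'r) fm" where "\<Gamma> = Eq (Var 0) (pair_tm ?p 2 3 4)"
  have "fv \<Gamma> \<subseteq> {0, 2, 3, 4}" using fv_pair_tm[of ?p 2 3 4] by (auto simp: \<Gamma>_def)
  moreover have "sat M s \<Gamma> \<longleftrightarrow> s 0 = pairing M ?p c (s 3) (s 4)" if "s 2 = c" for s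
    using that by (simp add: \<Gamma>_def eval_pair_tm)
  ultimately obtain A p where "small \<kappa> A" "p \<in> complete_types M 1 A" "weight \<kappa> M 1 A p = \<infinity>"
    using definable_pairing_infinite_weight[OF assms(2) c(2,1)] by metis
  then show False using assms(3) unfolding strongly_stable_def by (metis less_irrefl)
qed

end
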